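(* Let $\mathcal L$ be a finite distributive lattice, $R=\mathbb{C}[X_a : a\in\mathcal L]$, $I^h\subset R$ the ideal generated by $X_aX_b-X_{a\vee b}X_{a\wedge b}$ for all $a,b\in\mathcal L$, and $I^m\subset R$ the ideal generated by $X_aX_b$ for all incomparable pairs $a,b\in\mathcal L$. Then $C(I^h,I^m)$ consists exactly of the points $w\in\mathbb{R}^{\mathcal L}$ satisfying $w_a+w_b<w_{a\vee b}+w_{a\wedge b}$ for every diamond pair $\{a,b\}\subset\mathcal L$. Moreover this description is minimal: for every diamond pair $\{a,b\}$, the set of points of the closure $\overline{C(I^h,I^m)}$ at which $w_a+w_b=w_{a\vee b}+w_{a\wedge b}$ is a facet of $\overline{C(I^h,I^m)}$.
   Context: For $w\in\mathbb{R}^{\mathcal L}$ (coordinates $w_a$, $a\in\mathcal L$) and a polynomial $p=\sum_j c_j\mathbf X^{d^j}$ with $c_j\ne0$, $\mathrm{in}_w p$ is the sum of the terms $c_j\mathbf X^{d^j}$ of minimal $w$-weight $\sum_a w_a d^j_a$; $\mathrm{in}_w I$ is the span of $\mathrm{in}_w p$, $p\in I$; and $C(I,J)=\{w:\mathrm{in}_w I=J\}$. A two-element subset $\{a,b\}\subset\mathcal L$ is a diamond pair if $a\vee b$ covers both $a$ and $b$ and both $a$ and $b$ cover $a\wedge b$. *)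

theory Defs
  imports "HOL-Analysis.Analysis" "HOL-Library.Poly_Mapping"
begin

text \<open>A polynomial maps each exponent vector to its coefficient; the ring multiplication on this
  type is the convolution product, i.e. the usual product of polynomials.\<close>

type_synonym 'l cpoly = "('l \<Rightarrow>\<^sub>0 nat) \<Rightarrow>\<^sub>0 complex"

definition X :: "'l \<Rightarrow> 'l cpoly" where
  "X a = Poly_Mapping.single (Poly_Mapping.single a 1) 1"

definition cscale :: "complex \<Rightarrow> 'l cpoly \<Rightarrow> 'l cpoly" where
  "cscale c p = Poly_Mapping.single 0 c * p"

lemma module_mult: "module ((*) :: 'l cpoly \<Rightarrow> 'l cpoly \<Rightarrow> 'l cpoly)"
  by unfold_locales (simp_all add: algebra_simps)

lemma vector_space_cscale: "vector_space (cscale :: complex \<Rightarrow> 'l cpoly \<Rightarrow> 'l cpoly)"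
  by unfold_locales
    (simp_all add: cscale_def algebra_simps single_add mult_single flip: mult.assoc)

text \<open>An ideal is a submodule of the ring regarded as a module over itself.\<close>

definition ideal_gen :: "'l cpoly set \<Rightarrow> 'l cpoly set" where
  "ideal_gen = module.span (*)"

definition cspan :: "'l cpoly set \<Rightarrow> 'l cpoly set" where
  "cspan = module.span cscale"

definition weight :: "real ^ 'l::finite \<Rightarrow> ('l \<Rightarrow>\<^sub>0 nat) \<Rightarrow> real" where
  "weight w d = (\<Sum>a\<in>UNIV. w $ a * real (Poly_Mapping.lookup d a))"

definition init_form :: "real ^ 'l::finite \<Rightarrow> 'l cpoly \<Rightarrow> 'l cpoly" where
  "init_form w p =
    (\<Sum>d | d \<in> Poly_Mapping.keys p \<and> (\<forall>e\<in>Poly_Mapping.keys p. weight w d \<le> weight w e).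
       Poly_Mapping.single d (Poly_Mapping.lookup p d))"

definition init_ideal :: "real ^ 'l::finite \<Rightarrow> 'l cpoly set \<Rightarrow> 'l cpoly set" where
  "init_ideal w I = cspan (init_form w ` I)"

definition init_cone :: "'l::finite cpoly set \<Rightarrow> 'l cpoly set \<Rightarrow> (real ^ 'l) set" where
  "init_cone I J = {w. init_ideal w I = J}"

definition hibi_ideal :: "'l::lattice cpoly set" where
  "hibi_ideal = ideal_gen {X a * X b - X (sup a b) * X (inf a b) | a b. True}"

definition monomial_ideal :: "'l::lattice cpoly set" where
  "monomial_ideal = ideal_gen {X a * X b | a b. \<not> a \<le> b \<and> \<not> b \<le> a}"

definition covers :: "'l::order \<Rightarrow> 'l \<Rightarrow> bool" where
  "covers a b \<longleftrightarrow> b < a \<and> (\<nexists>c. b < c \<and> c < a)"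

definition diamond_pair :: "'l::lattice \<Rightarrow> 'l \<Rightarrow> bool" where
  "diamond_pair a b \<longleftrightarrow> a \<noteq> b \<and> covers (sup a b) a \<and> covers (sup a b) b
     \<and> covers a (inf a b) \<and> covers b (inf a b)"

end

theory Submission
  imports Defs
begin

text \<open>
  In a distributive lattice the diamond inequalities add up to strict supermodularity of \<open>w\<close> on all
  incomparable pairs. The toric map sending \<open>X a\<close> to the product of the variables indexed by the
  join-primes below \<open>a\<close> kills the Hibi ideal and separates standard monomials (those supported on
  chains). Straightening \<open>a, b\<close> to \<open>sup a b, inf a b\<close> stays in a fibre of that map and increases the
  weight, so the standard monomial is the unique monomial of maximal weight in its finite fibre. As
  the coefficients of a member of the Hibi ideal sum to zero over each fibre, none of its initial
  terms can be standard.

  Each facet is exhibited by a point \<open>w x = (\<Sum>z | z \<le> x. v z)\<close> which is tight at exactly one diamond: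
  the excess of such a \<open>w\<close> at \<open>c, d\<close> is the sum of \<open>v\<close> over the elements that are below \<open>sup c d\<close>
  but neither below \<open>c\<close> nor below \<open>d\<close>.
\<close>

section \<open>Supermodular functions and diamonds\<close>

definition incomparable :: "'l::order \<Rightarrow> 'l \<Rightarrow> bool" where
  "incomparable a b \<longleftrightarrow> \<not> a \<le> b \<and> \<not> b \<le> a"

lemma incomparable_sym: "incomparable a b \<Longrightarrow> incomparable b a"
  by (simp add: incomparable_def)

lemma diamond_pair_imp_incomparable:
  fixes a b :: "'l::lattice"
  assumes "diamond_pair a b"
  shows "incomparable a b"
  using assms by (auto simp: diamond_pair_def incomparable_def covers_def sup.absorb1 sup.absorb2)

text \<open>For \<open>c\<close> strictly between \<open>x\<close> and \<open>sup x y\<close>, the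
  element \<open>inf y c\<close> lies between \<open>inf x y\<close> and \<open>y\<close>, so it is
  one of the two. In the first case distributivity gives \<open>c = x\<close>, in the second
  \<open>y\<close> lies below \<open>c\<close>; both are absurd.\<close>

lemma diamond_pair_if_covers_inf:
  fixes a b :: "'l::distrib_lattice"
  assumes "incomparable a b" "covers a (inf a b)" "covers b (inf a b)"
  shows "diamond_pair a b"
proof -
  have *: "covers (sup x y) x" if xy: "incomparable x y" "covers y (inf x y)" for x y :: 'l
    unfolding covers_def
  proof (intro conjI notI)
    show "x < sup x y"
      using xy(1) by (metis incomparable_def less_le sup.cobounded1 sup.cobounded2)
    assume "\<exists>c. x < c \<and> c < sup x y"
    then obtain c where c: "x < c" "c < sup x y" by blast
    have "inf x y \<le> inf y c" "inf y c \<le> y"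
      using c(1) by (auto intro: le_infI1 le_infI2 less_imp_le)
    then consider "inf y c = inf x y" | "inf y c = y"
      using xy(2) unfolding covers_def by (metis le_less)
    then show False
    proof cases
      case 1
      have "c = inf c (sup x y)" using c(2) by (simp add: inf.absorb1)
      also have "\<dots> = sup (inf c x) (inf c y)" by (rule inf_sup_distrib1)
      also have "inf c x = x" using c(1) by (simp add: inf.absorb2)
      also have "inf c y = inf x y" using 1 by (simp add: inf_commute)
      finally show False using c(1) by simp
    next
      case 2
      then have "y \<le> c" by (metis inf.cobounded2)
      then show False using c by (metis le_sup_iff less_imp_le leD)
    qed
  qed
  have "covers (sup a b) a" "covers (sup b a) b"
    using *[of a b] *[of b a] assms by (auto simp: inf_commute incomparable_sym)
  with assms show ?thesis
    by (auto simp: diamond_pair_def incomparable_def sup_commute)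
qed

text \<open>Induction on the size of the interval from meet to join: either both elements cover the
  meet and form a diamond, or the pair splits into two pairs with smaller intervals.\<close>

lemma strictly_supermodular_if_diamonds:
  fixes f :: "'l::{finite, distrib_lattice} \<Rightarrow> real"
  assumes dia: "\<And>a b. diamond_pair a b \<Longrightarrow> f a + f b < f (sup a b) + f (inf a b)"
    and "incomparable a b"
  shows "f a + f b < f (sup a b) + f (inf a b)"
  using assms(2)
proof (induction "card {inf a b..sup a b}" arbitrary: a b rule: less_induct)
  case less
  have smaller: "card {x..y} < card {inf c d..sup c d}"
    if "inf c d \<le> x" "y \<le> sup c d" "inf c d < x \<or> y < sup c d" for x y c d :: 'l
  proof (rule psubset_card_mono)
    have "inf c d \<notin> {x..y} \<or> sup c d \<notin> {x..y}"
      using that(3) by (meson atLeastAtMost_iff leD)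
    moreover have "inf c d \<le> sup c d" by (simp add: le_infI1 le_supI1)
    ultimately show "{x..y} \<subset> {inf c d..sup c d}"
      using that(1,2) by (auto intro: order_trans)
  qed simp
  \<comment> \<open>An element \<open>c\<close> strictly between \<open>inf a b\<close> and \<open>a\<close> cuts the rectangle of \<open>a, b\<close> into those of
    \<open>c, b\<close> and \<open>a, sup c b\<close>, whose inequalities add up.\<close>
  have split: "f x + f y < f (sup x y) + f (inf x y)"
    if xy: "incomparable x y" "inf x y = inf a b" "sup x y = sup a b"
      and c: "inf x y < c" "c < x" for x y c
  proof -
    have inf_cy: "inf c y = inf x y"
      using c by (metis inf.absorb1 inf.assoc inf.commute less_imp_le)
    have inf_x: "inf x (sup c y) = c"
      using c by (simp add: inf_sup_distrib1 inf.absorb2 sup.absorb1 less_imp_le)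
    have sup_x: "sup x (sup c y) = sup x y"
      using c(2) by (metis sup.absorb1 sup.assoc less_imp_le)
    have inc1: "incomparable c y"
      unfolding incomparable_def
    proof
      show "\<not> c \<le> y" using c inf_cy by (metis inf.absorb1 less_irrefl)
      show "\<not> y \<le> c" using c(2) xy(1) by (meson incomparable_def le_less_trans less_imp_le)
    qed
    have inc2: "incomparable x (sup c y)"
      unfolding incomparable_def
    proof
      show "\<not> x \<le> sup c y" using c(2) inf_x by (metis inf.absorb1 less_irrefl)
      show "\<not> sup c y \<le> x" using xy(1) by (auto simp: incomparable_def)
    qed
    have "sup c y \<noteq> sup x y"
      using inc2 by (auto simp: incomparable_def)
    moreover have "sup c y \<le> sup x y" using sup_x by (metis sup.cobounded2)
    ultimately have "card {inf c y..sup c y} < card {inf x y..sup x y}"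
      by (intro smaller) (auto simp: inf_cy order_less_le)
    then have 1: "f c + f y < f (sup c y) + f (inf c y)"
      using inc1 less.hyps xy(2,3) by simp
    have "card {inf x (sup c y)..sup x (sup c y)} < card {inf x y..sup x y}"
      using c by (intro smaller) (auto simp: inf_x sup_x less_imp_le)
    then have "f x + f (sup c y) < f (sup x (sup c y)) + f (inf x (sup c y))"
      using inc2 less.hyps xy(2,3) by simp
    with 1 show ?thesis by (simp add: inf_cy inf_x sup_x)
  qed
  have lt: "inf a b < a" "inf a b < b"
    using less.prems by (metis incomparable_def inf.cobounded1 inf.cobounded2 order_le_neq_trans)+
  show ?case
  proof (cases "covers a (inf a b) \<and> covers b (inf a b)")
    case True
    then show ?thesis using diamond_pair_if_covers_inf[OF less.prems] dia by blast
  next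
    case False
    then consider c where "inf a b < c" "c < a" | c where "inf a b < c" "c < b"
      using lt by (auto simp: covers_def)
    then show ?thesis
    proof cases
      case 1
      then show ?thesis using split less.prems by blast
    next
      case 2
      then show ?thesis using split[of b a] incomparable_sym[OF less.prems]
        by (simp add: inf_commute sup_commute add.commute)
    qed
  qed
qed

section \<open>Points with prescribed diamond excesses\<close>

definition new_below :: "'l::lattice \<Rightarrow> 'l \<Rightarrow> 'l set" where
  "new_below c d = {z. z \<le> sup c d \<and> \<not> z \<le> c \<and> \<not> z \<le> d}"

definition down_sum :: "('l \<Rightarrow> real) \<Rightarrow> real ^ 'l::{finite, lattice}" where
  "down_sum v = (\<chi> x. \<Sum>z | z \<le> x. v z)"

text \<open>Inclusion-exclusion for the down-sets of \<open>c\<close> and \<open>d\<close>: they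
  intersect in the down-set of \<open>inf c d\<close>, and \<open>new_below c d\<close> is what
  their union misses of the down-set of \<open>sup c d\<close>.\<close>

lemma down_sum_excess:
  fixes v :: "'l::{finite, lattice} \<Rightarrow> real"
  shows "down_sum v $ sup c d + down_sum v $ inf c d =
    down_sum v $ c + down_sum v $ d + (\<Sum>z\<in>new_below c d. v z)"
proof -
  have "{z. z \<le> sup c d} = ({z. z \<le> c} \<union> {z. z \<le> d}) \<union> new_below c d"
    by (auto simp: new_below_def intro: le_supI1 le_supI2)
  then have "(\<Sum>z | z \<le> sup c d. v z) = (\<Sum>z\<in>{z. z \<le> c} \<union> {z. z \<le> d}. v z) + (\<Sum>z\<in>new_below c d. v z)"
    by (simp only:) (rule sum.union_disjoint, auto simp: new_below_def)
  moreover have "{z. z \<le> inf c d} = {z. z \<le> c} \<inter> {z. z \<le> d}" by auto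
  ultimately show ?thesis
    using sum.union_inter[of "{z. z \<le> c}" "{z. z \<le> d}" v] by (simp add: down_sum_def)
qed

lemma sup_in_new_below: "incomparable c d \<Longrightarrow> sup c d \<in> new_below c d"
  by (auto simp: new_below_def incomparable_def)

text \<open>This point shows that the open cone is nonempty, and as a direction it pushes points of
  the weak cone into the open one.\<close>

lemma down_sum_one_strict:
  fixes c d :: "'l::{finite, lattice}"
  assumes "diamond_pair c d"
  shows "down_sum (\<lambda>_. 1) $ c + down_sum (\<lambda>_. 1) $ d
    < down_sum (\<lambda>_. 1) $ sup c d + down_sum (\<lambda>_. 1) $ inf c d"
proof -
  have "0 < card (new_below c d)"
    using sup_in_new_below[OF diamond_pair_imp_incomparable[OF assms]] by (auto simp: card_gt_0_iff)
  then show ?thesis by (simp add: down_sum_excess)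
qed

lemma covers_antichain: "covers s x \<Longrightarrow> covers s y \<Longrightarrow> x \<noteq> y \<Longrightarrow> \<not> x \<le> y"
  unfolding covers_def by (metis le_less)

text \<open>Near such a point the hyperplane of \<open>a, b\<close> is cut by no other diamond
  inequality, so the face of \<open>a, b\<close> contains an open piece of its hyperplane.\<close>

lemma tight_at_one_diamond:
  fixes a b :: "'l::{finite, lattice}"
  assumes ab: "diamond_pair a b"
  obtains w :: "real ^ 'l::{finite, lattice}"
  where "w $ a + w $ b = w $ sup a b + w $ inf a b"
    and "\<And>c d. diamond_pair c d \<Longrightarrow> {c, d} \<noteq> {a, b} \<Longrightarrow> w $ c + w $ d < w $ sup c d + w $ inf c d"
proof -
  define s where "s = sup a b"
  define N where "N = new_below a b"
  define t where "t = real (card N)"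
  \<comment> \<open>The weight at \<open>s\<close> makes the excess of \<open>a, b\<close> vanish. Any other diamond whose excess involves
    \<open>s\<close> also involves some \<open>z \<notin> N\<close>, whose weight \<open>t\<close> outweighs it.\<close>
  define v where "v z = (if z = s then 1 - t else if z \<in> N then 1 else t)" for z
  have sN: "s \<in> N"
    using sup_in_new_below diamond_pair_imp_incomparable ab unfolding s_def N_def by blast
  then have "card N \<ge> 1" by (simp add: Suc_le_eq card_gt_0_iff) blast
  then have t1: "t \<ge> 1" by (simp add: t_def)
  have v_pos: "v z > 0" if "z \<noteq> s" for z using that t1 by (simp add: v_def)
  have "sum v N = v s + sum v (N - {s})" using sN by (simp add: sum.remove)
  also have "sum v (N - {s}) = (\<Sum>z\<in>N - {s}. 1)" by (rule sum.cong) (auto simp: v_def)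
  also have "\<dots> = t - 1" using sN \<open>card N \<ge> 1\<close> by (simp add: t_def of_nat_diff)
  finally have "sum v N = 0" by (simp add: v_def)
  then have eq: "down_sum v $ a + down_sum v $ b = down_sum v $ sup a b + down_sum v $ inf a b"
    by (simp add: down_sum_excess N_def)
  have "sum v (new_below c d) > 0" if cd: "diamond_pair c d" "{c, d} \<noteq> {a, b}" for c d
  proof (cases "s \<in> new_below c d")
    case False
    then show ?thesis
      using sup_in_new_below[OF diamond_pair_imp_incomparable[OF cd(1)]] v_pos
      by (intro sum_pos) (auto, metis)
  next
    case True
    \<comment> \<open>If \<open>sup c d\<close> is not \<open>s\<close>, it lies strictly above
      \<open>s\<close> and serves as \<open>z\<close>. Otherwise \<open>s\<close> covers all four
      elements, and one of \<open>a\<close>, \<open>b\<close> differs from both \<open>c\<close> and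
      \<open>d\<close>; it is incomparable to them and serves as \<open>z\<close>.\<close>
    have "\<exists>z\<in>new_below c d. z \<notin> N"
    proof (cases "sup c d = s")
      case False
      with True have "s < sup c d" by (auto simp: new_below_def order_less_le)
      then have "sup c d \<notin> N" unfolding N_def new_below_def s_def using leD by blast
      then show ?thesis using sup_in_new_below diamond_pair_imp_incomparable cd(1) by blast
    next
      case sup_cd: True
      have ne: "a \<noteq> b" "c \<noteq> d" using ab cd(1) by (auto simp: diamond_pair_def)
      with cd(2) obtain x where x: "x \<in> {a, b}" "x \<noteq> c" "x \<noteq> d" by blast
      have "covers s x" "covers s c" "covers s d"
        using x(1) ab cd(1) sup_cd by (auto simp: diamond_pair_def s_def)
      then have "x \<in> new_below c d"
        using x(2,3) covers_antichain by (auto simp: new_below_def sup_cd covers_def)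
      moreover have "x \<notin> N" using x(1) by (auto simp: N_def new_below_def)
      ultimately show ?thesis by blast
    qed
    then obtain z where z: "z \<in> new_below c d" "z \<notin> N" by blast
    then have "z \<noteq> s" using sN by blast
    have "0 < v s + v z" using z \<open>z \<noteq> s\<close> by (simp add: v_def)
    also have "\<dots> = sum v {s, z}" using \<open>z \<noteq> s\<close> by simp
    also have "\<dots> \<le> sum v (new_below c d)"
      using True z(1) v_pos by (intro sum_mono2) (auto intro: less_imp_le)
    finally show ?thesis .
  qed
  then show thesis using that[OF eq] by (simp add: down_sum_excess)
qed

section \<open>Closure and facets of the diamond cone\<close>

lemma open_Collect_all_finite:
  fixes P :: "'i::finite \<Rightarrow> 'a::topological_space \<Rightarrow> bool"
  assumes "\<And>i. open {x. P i x}"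
  shows "open {x. \<forall>i. P i x}"
  unfolding Collect_all_eq using assms by (intro open_INT) auto

text \<open>The weak inequalities define a closed set, and adding vanishing positive multiples of
  \<open>down_sum (\<lambda>_. 1)\<close> approximates each of its points by points of
  \<open>D\<close>.\<close>

lemma closure_diamond_cone:
  fixes D :: "(real ^ 'l::{finite, lattice}) set"
  defines "D \<equiv> {w. \<forall>a b. diamond_pair a b \<longrightarrow> w $ a + w $ b < w $ sup a b + w $ inf a b}"
  shows "closure D = {w. \<forall>a b. diamond_pair a b \<longrightarrow> w $ a + w $ b \<le> w $ sup a b + w $ inf a b}"
    (is "_ = ?E")
proof
  have "closed ?E"
    by (intro closed_Collect_all closed_Collect_imp open_Collect_const closed_Collect_le continuous_intros)
  then show "closure D \<subseteq> ?E"
    by (intro closure_minimal) (auto simp: D_def less_imp_le)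
  show "?E \<subseteq> closure D"
  proof
    fix w assume w: "w \<in> ?E"
    let ?h = "down_sum (\<lambda>_. 1) :: (real, 'l) vec"
    define g where "g n = w + (1 / real (Suc n)) *\<^sub>R ?h" for n
    have "g n \<in> D" for n
      unfolding D_def
    proof (intro CollectI allI impI)
      fix a b :: 'l
      assume ab: "diamond_pair a b"
      have "(1 / real (Suc n)) * (?h $ a + ?h $ b) < (1 / real (Suc n)) * (?h $ sup a b + ?h $ inf a b)"
        by (rule mult_strict_left_mono[OF down_sum_one_strict[OF ab]]) simp
      moreover have "w $ a + w $ b \<le> w $ sup a b + w $ inf a b" using w ab by blast
      ultimately show "g n $ a + g n $ b < g n $ sup a b + g n $ inf a b"
        unfolding g_def vector_add_component vector_scaleR_component real_scaleR_def
        by (simp only: distrib_left)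
    qed
    moreover have "g \<longlonglongrightarrow> w + 0 *\<^sub>R ?h"
      unfolding g_def by (intro tendsto_intros LIMSEQ_Suc[OF lim_1_over_n])
    ultimately show "w \<in> closure D"
      unfolding closure_sequential by auto
  qed
qed

lemma diamond_facet:
  fixes D :: "(real ^ 'l::{finite, lattice}) set"
  defines "D \<equiv> {w. \<forall>a b. diamond_pair a b \<longrightarrow> w $ a + w $ b < w $ sup a b + w $ inf a b}"
  assumes ab: "diamond_pair a b"
  shows "{w \<in> closure D. w $ a + w $ b = w $ sup a b + w $ inf a b} facet_of closure D"
proof -
  \<comment> \<open>The normal vector whose inner product with \<open>w\<close> is the excess of
    \<open>w\<close> at \<open>a, b\<close>. It is nonzero because \<open>sup a b\<close> differs
    from the other three elements.\<close>
  define n :: "(real, 'l) vec" where "n = axis (sup a b) 1 + axis (inf a b) 1 - axis a 1 - axis b 1"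
  have n: "n \<bullet> w = w $ sup a b + w $ inf a b - w $ a - w $ b" for w
    by (simp add: n_def inner_axis' algebra_simps)
  have "sup a b \<noteq> a" "sup a b \<noteq> b" "sup a b \<noteq> inf a b"
    using ab by (auto simp: diamond_pair_def covers_def)
  then have "n $ sup a b = 1" by (simp add: n_def axis_def)
  then have n0: "n \<noteq> 0" by auto
  have clD: "closure D = {w. \<forall>a b. diamond_pair a b \<longrightarrow> w $ a + w $ b \<le> w $ sup a b + w $ inf a b}"
    unfolding D_def by (rule closure_diamond_cone)
  define F where "F = {w \<in> closure D. w $ a + w $ b = w $ sup a b + w $ inf a b}"
  have F: "F = closure D \<inter> {w. n \<bullet> w = 0}" by (auto simp: F_def n)
  have "convex D"
    unfolding D_def convex_def
  proof (intro ballI allI impI CollectI)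
    fix x y :: "(real, 'l) vec" and u t :: real and c d :: 'l
    assume x: "x \<in> {w. \<forall>a b. diamond_pair a b \<longrightarrow> w $ a + w $ b < w $ sup a b + w $ inf a b}"
      and y: "y \<in> {w. \<forall>a b. diamond_pair a b \<longrightarrow> w $ a + w $ b < w $ sup a b + w $ inf a b}"
      and ut: "0 \<le> u" "0 \<le> t" "u + t = 1" and cd: "diamond_pair c d"
    let ?e = "\<lambda>w :: (real, 'l) vec. w $ sup c d + w $ inf c d - w $ c - w $ d"
    have "0 < ?e x" "0 < ?e y" using x y cd by (simp_all add: algebra_simps)
    then have "0 < u * ?e x + t * ?e y"
      using ut by (cases "u = 0") (auto intro: add_pos_nonneg)
    then show "(u *\<^sub>R x + t *\<^sub>R y) $ c + (u *\<^sub>R x + t *\<^sub>R y) $ d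
      < (u *\<^sub>R x + t *\<^sub>R y) $ sup c d + (u *\<^sub>R x + t *\<^sub>R y) $ inf c d"
      by (simp add: algebra_simps)
  qed
  have face: "F face_of closure D"
    unfolding F using \<open>convex D\<close> ab
    by (intro face_of_Int_supporting_hyperplane_ge convex_closure) (auto simp: clD n algebra_simps)
  have "open D"
    unfolding D_def
    by (intro open_Collect_all_finite open_Collect_imp closed_Collect_const open_Collect_less continuous_intros)
  moreover have "D \<noteq> {}" using down_sum_one_strict unfolding D_def by blast
  ultimately have dimD: "aff_dim (closure D) = int DIM((real, 'l) vec)"
    by (simp add: aff_dim_open)
  \<comment> \<open>All diamond inequalities except that of \<open>a, b\<close> in either order.
    This open set meets the hyperplane in \<open>w0\<close>, so the intersection has the full
    dimension of the hyperplane.\<close>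
  define T :: "(real, 'l) vec set" where "T = {w. \<forall>c d. diamond_pair c d \<and> {c, d} \<noteq> {a, b} \<longrightarrow>
    w $ c + w $ d < w $ sup c d + w $ inf c d}"
  obtain w0 :: "(real, 'l) vec" where "w0 $ a + w0 $ b = w0 $ sup a b + w0 $ inf a b"
    "\<And>c d. diamond_pair c d \<Longrightarrow> {c, d} \<noteq> {a, b} \<Longrightarrow> w0 $ c + w0 $ d < w0 $ sup c d + w0 $ inf c d"
    using tight_at_one_diamond[OF ab] by blast
  then have w0: "w0 \<in> {w. n \<bullet> w = 0} \<inter> T" by (auto simp: n T_def)
  have "open T"
    unfolding T_def
    by (intro open_Collect_all_finite open_Collect_imp closed_Collect_const open_Collect_less continuous_intros)
  then have "aff_dim ({w. n \<bullet> w = 0} \<inter> T) = aff_dim {w. n \<bullet> w = 0}"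
    using w0 by (intro aff_dim_convex_Int_open convex_hyperplane) auto
  then have dimT: "aff_dim ({w. n \<bullet> w = 0} \<inter> T) = int DIM((real, 'l) vec) - 1"
    using n0 by (simp add: aff_dim_hyperplane)
  have sub: "{w. n \<bullet> w = 0} \<inter> T \<subseteq> F"
  proof
    fix w assume w: "w \<in> {w. n \<bullet> w = 0} \<inter> T"
    have "w $ c + w $ d \<le> w $ sup c d + w $ inf c d" if cd: "diamond_pair c d" for c d
    proof (cases "{c, d} = {a, b}")
      case True
      then show ?thesis using w by (auto simp: n doubleton_eq_iff sup_commute inf_commute)
    next
      case False
      then show ?thesis using w cd by (force simp: T_def)
    qed
    then show "w \<in> F" using w by (auto simp: F clD)
  qed
  have "aff_dim F = int DIM((real, 'l) vec) - 1"
  proof (rule antisym)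
    have "aff_dim F \<le> aff_dim {w. n \<bullet> w = 0}" unfolding F by (intro aff_dim_subset) auto
    then show "aff_dim F \<le> int DIM((real, 'l) vec) - 1" using n0 by (simp add: aff_dim_hyperplane)
    show "int DIM((real, 'l) vec) - 1 \<le> aff_dim F" using aff_dim_subset[OF sub] dimT by simp
  qed
  moreover have "F \<noteq> {}" using w0 sub by blast
  ultimately have "F facet_of closure D"
    using face dimD by (simp only: facet_of_def simp_thms)
  then show ?thesis by (simp only: F_def)
qed

section \<open>Standard monomials and the Hibi ideal\<close>

lemma sum_lookup_singles:
  fixes p :: "'b \<Rightarrow>\<^sub>0 'a::comm_monoid_add"
  shows "(\<Sum>d\<in>Poly_Mapping.keys p. Poly_Mapping.single d (Poly_Mapping.lookup p d)) = p"
  by (rule poly_mapping_eqI) (auto simp: lookup_sum lookup_single when_def in_keys_iff)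

lemma X_mult_X: "X a * X b = Poly_Mapping.single (Poly_Mapping.single a 1 + Poly_Mapping.single b 1) 1"
  by (simp add: X_def mult_single)

text \<open>Polynomials carry two module structures: over themselves, where spans are ideals, and
  over the complex numbers, where the span of the initial forms is taken.\<close>

interpretation poly_ideal: module "(*) :: 'l cpoly \<Rightarrow> 'l cpoly \<Rightarrow> 'l cpoly"
  rewrites "module.span (*) = (ideal_gen :: 'l cpoly set \<Rightarrow> 'l cpoly set)"
  by (rule module_mult) (simp add: ideal_gen_def)

interpretation poly_vec: vector_space "cscale :: complex \<Rightarrow> 'l cpoly \<Rightarrow> 'l cpoly"
  rewrites "module.span cscale = (cspan :: 'l cpoly set \<Rightarrow> 'l cpoly set)"
  by (rule vector_space_cscale) (simp add: cspan_def)

definition standard :: "('l::order \<Rightarrow>\<^sub>0 nat) \<Rightarrow> bool" where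
  "standard d \<longleftrightarrow> (\<forall>a\<in>Poly_Mapping.keys d. \<forall>b\<in>Poly_Mapping.keys d. \<not> incomparable a b)"

lemma nonstandardE:
  assumes "\<not> standard d"
  obtains a b e where "incomparable a b" "d = e + (Poly_Mapping.single a 1 + Poly_Mapping.single b 1)"
proof -
  obtain a b where ab: "a \<in> Poly_Mapping.keys d" "b \<in> Poly_Mapping.keys d" "incomparable a b"
    using assms by (auto simp: standard_def)
  \<comment> \<open>Subtraction of exponents is truncated; it is exact below because
    \<open>a\<close> and \<open>b\<close> are distinct and both occur in \<open>d\<close>.\<close>
  then have "a \<noteq> b" by (auto simp: incomparable_def)
  then have "d = (d - (Poly_Mapping.single a 1 + Poly_Mapping.single b 1))
      + (Poly_Mapping.single a 1 + Poly_Mapping.single b 1)"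
    using ab(1,2)
    by (intro poly_mapping_eqI)
      (auto simp: lookup_add lookup_minus lookup_single when_def in_keys_iff)
  then show thesis using that ab(3) by blast
qed

lemma not_standard_add:
  fixes d e :: "'l::order \<Rightarrow>\<^sub>0 nat"
  assumes "\<not> standard e"
  shows "\<not> standard (d + e)"
proof -
  have "Poly_Mapping.keys e \<subseteq> Poly_Mapping.keys (d + e)"
    by (auto simp: in_keys_iff lookup_add)
  then show ?thesis using assms unfolding standard_def by blast
qed

text \<open>Every term of a multiple of a generator still involves an incomparable pair; conversely,
  every nonstandard term is itself a multiple of a generator.\<close>

lemma monomial_ideal_iff:
  fixes p :: "'l::lattice cpoly"
  shows "p \<in> monomial_ideal \<longleftrightarrow> (\<forall>d\<in>Poly_Mapping.keys p. \<not> standard d)"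
proof
  assume "p \<in> monomial_ideal"
  then show "\<forall>d\<in>Poly_Mapping.keys p. \<not> standard d"
    unfolding monomial_ideal_def
  proof (induction rule: poly_ideal.span_induct_alt)
    case base
    then show ?case by simp
  next
    case (step c x y)
    then obtain a b where ab: "x = X a * X b" "incomparable a b"
      by (auto simp: incomparable_def)
    have "\<not> standard d" if "d \<in> Poly_Mapping.keys (c * x)" for d
    proof -
      from that obtain d' e where "d = d' + e" "e \<in> Poly_Mapping.keys x"
        using keys_mult by blast
      moreover then have "e = Poly_Mapping.single a 1 + Poly_Mapping.single b 1"
        by (simp add: ab X_mult_X)
      moreover have "\<not> standard (Poly_Mapping.single a 1 + Poly_Mapping.single b 1)"
        using ab(2) by (force simp: standard_def in_keys_iff lookup_add lookup_single)
      ultimately show ?thesis using not_standard_add by blast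
    qed
    then show ?case using step.IH keys_add[of "c * x" y] by blast
  qed
next
  assume nonstd: "\<forall>d\<in>Poly_Mapping.keys p. \<not> standard d"
  have "Poly_Mapping.single d (Poly_Mapping.lookup p d) \<in> monomial_ideal"
    if "d \<in> Poly_Mapping.keys p" for d
  proof -
    obtain a b e where ab: "incomparable a b"
      and d: "d = e + (Poly_Mapping.single a 1 + Poly_Mapping.single b 1)"
      using nonstd \<open>d \<in> _\<close> nonstandardE by blast
    have "Poly_Mapping.single d (Poly_Mapping.lookup p d) =
        Poly_Mapping.single e (Poly_Mapping.lookup p d) * (X a * X b)"
      by (simp add: X_mult_X mult_single d)
    moreover have "X a * X b \<in> monomial_ideal"
      unfolding monomial_ideal_def using ab
      by (intro poly_ideal.span_base) (auto simp: incomparable_def)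
    ultimately show ?thesis
      unfolding monomial_ideal_def by (simp only: poly_ideal.span_scale)
  qed
  then have "(\<Sum>d\<in>Poly_Mapping.keys p. Poly_Mapping.single d (Poly_Mapping.lookup p d)) \<in> monomial_ideal"
    unfolding monomial_ideal_def by (rule poly_ideal.span_sum)
  then show "p \<in> monomial_ideal" by (simp add: sum_lookup_singles)
qed

section \<open>Fibres of the toric map\<close>

definition join_prime :: "'l::lattice \<Rightarrow> bool" where
  "join_prime j \<longleftrightarrow> (\<forall>a b. j \<le> sup a b \<longrightarrow> j \<le> a \<or> j \<le> b)"

definition upper_degree :: "('l::{finite, order} \<Rightarrow>\<^sub>0 nat) \<Rightarrow> 'l \<Rightarrow> nat" where
  "upper_degree d u = (\<Sum>a | u \<le> a. Poly_Mapping.lookup d a)"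

text \<open>The values of \<open>upper_degree d\<close> at the join-primes are the exponents of the image of the monomial
  \<open>d\<close> under the toric map whose kernel is the Hibi ideal; the bottom element, which counts as
  join-prime here, records the degree.\<close>

definition fibre :: "('l::{finite, lattice} \<Rightarrow>\<^sub>0 nat) \<Rightarrow> ('l \<Rightarrow>\<^sub>0 nat) set" where
  "fibre d = {e. \<forall>j. join_prime j \<longrightarrow> upper_degree e j = upper_degree d j}"

lemma upper_degree_add: "upper_degree (d + e) u = upper_degree d u + upper_degree e u"
  by (simp add: upper_degree_def lookup_add sum.distrib)

lemma upper_degree_single: "upper_degree (Poly_Mapping.single a n) u = (if u \<le> a then n else 0)"
  by (simp add: upper_degree_def lookup_single when_def)

text \<open>A join-prime below the join is below \<open>a\<close> or \<open>b\<close>, so it lies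
  below equally many members of each pair. Thus the toric map identifies the two monomials of a Hibi
  binomial.\<close>

lemma upper_degree_swap:
  fixes a b :: "'l::{finite, lattice}"
  assumes "join_prime j"
  shows "upper_degree (e + (Poly_Mapping.single (sup a b) 1 + Poly_Mapping.single (inf a b) 1)) j =
    upper_degree (e + (Poly_Mapping.single a 1 + Poly_Mapping.single b 1)) j"
proof -
  have "j \<le> sup a b \<longleftrightarrow> j \<le> a \<or> j \<le> b"
    using assms by (auto simp: join_prime_def intro: le_supI1 le_supI2)
  then show ?thesis by (simp add: upper_degree_add upper_degree_single)
qed

lemma swap_in_fibre_iff:
  fixes a b :: "'l::{finite, lattice}"
  shows "e + (Poly_Mapping.single (sup a b) 1 + Poly_Mapping.single (inf a b) 1) \<in> fibre d \<longleftrightarrow>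
    e + (Poly_Mapping.single a 1 + Poly_Mapping.single b 1) \<in> fibre d"
  by (simp only: fibre_def mem_Collect_eq upper_degree_swap cong: imp_cong)

text \<open>The bottom element is join-prime and its upper degree is the total degree, which bounds
  every exponent.\<close>

lemma finite_fibre:
  fixes d :: "'l::{finite, lattice} \<Rightarrow>\<^sub>0 nat"
  shows "finite (fibre d)"
proof -
  define m where "m = Inf_fin (UNIV :: 'l set)"
  have m: "m \<le> x" for x unfolding m_def by (rule Inf_fin.coboundedI) auto
  then have "join_prime m" by (simp add: join_prime_def)
  have "Poly_Mapping.lookup e a \<le> upper_degree d m" if "e \<in> fibre d" for e a
  proof -
    have "Poly_Mapping.lookup e a \<le> upper_degree e m"
      unfolding upper_degree_def by (rule member_le_sum) (auto simp: m)
    then show ?thesis using that \<open>join_prime m\<close> by (simp add: fibre_def)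
  qed
  then have "Poly_Mapping.lookup ` fibre d \<subseteq> Pi\<^sub>E UNIV (\<lambda>_. {..upper_degree d m})"
    by auto
  then have "finite (Poly_Mapping.lookup ` fibre d)"
    by (rule finite_subset) (auto intro: finite_PiE)
  then show ?thesis
    by (rule finite_imageD) (auto intro: inj_onI poly_mapping_eqI)
qed

text \<open>A minimal \<open>j\<close> below \<open>u\<close> but not below \<open>a\<close> is
  join-prime: if it lay below \<open>sup x y\<close> but below neither \<open>x\<close> nor
  \<open>y\<close>, then \<open>inf j x\<close> and \<open>inf j y\<close> would be strictly
  smaller, hence below \<open>a\<close>, and so would their join \<open>j\<close>.\<close>

lemma le_iff_join_primes_le:
  fixes u a :: "'l::{finite, distrib_lattice}"
  shows "u \<le> a \<longleftrightarrow> (\<forall>j. join_prime j \<longrightarrow> j \<le> u \<longrightarrow> j \<le> a)"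
proof
  assume r: "\<forall>j. join_prime j \<longrightarrow> j \<le> u \<longrightarrow> j \<le> a"
  show "u \<le> a"
  proof (rule ccontr)
    assume "\<not> u \<le> a"
    then obtain j where j: "j \<le> u" "\<not> j \<le> a"
      and min: "\<And>i. i \<le> u \<Longrightarrow> \<not> i \<le> a \<Longrightarrow> i \<le> j \<Longrightarrow> i = j"
      using finite_has_minimal2[of "{j. j \<le> u \<and> \<not> j \<le> a}" u] by auto
    have "join_prime j"
      unfolding join_prime_def
    proof (intro allI impI)
      fix x y
      assume "j \<le> sup x y"
      then have eq: "j = sup (inf j x) (inf j y)"
        by (metis inf.absorb1 inf_sup_distrib1)
      show "j \<le> x \<or> j \<le> y"
      proof (rule ccontr)
        assume "\<not> (j \<le> x \<or> j \<le> y)"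
        then have "inf j x \<noteq> j" "inf j y \<noteq> j" by (metis inf.cobounded2)+
        then have "inf j x \<le> a" "inf j y \<le> a"
          using min[of "inf j x"] min[of "inf j y"] j(1) by (auto intro: le_infI1)
        then show False using j(2) eq by (metis le_supI)
      qed
    qed
    then show False using r j by blast
  qed
qed auto

text \<open>On a chain the up-sets \<open>{a. j \<le> a}\<close> are nested, so the upper degree at \<open>u\<close> is the least upper
  degree at a join-prime below \<open>u\<close>.\<close>

lemma upper_degree_standard:
  fixes d :: "'l::{finite, distrib_lattice} \<Rightarrow>\<^sub>0 nat"
  assumes "standard d"
  shows "upper_degree d u = Min (upper_degree d ` {j. join_prime j \<and> j \<le> u})"
proof -
  define J where "J = {j. join_prime j \<and> j \<le> u}"
  define m where "m = Inf_fin (UNIV :: 'l set)"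
  have m: "m \<le> x" for x unfolding m_def by (rule Inf_fin.coboundedI) auto
  then have "m \<in> J" by (simp add: join_prime_def J_def)
  define U where "U j = {a \<in> Poly_Mapping.keys d. j \<le> a}" for j
  have upper_degree_U: "upper_degree d j = sum (Poly_Mapping.lookup d) (U j)" for j
    unfolding upper_degree_def by (rule sum.mono_neutral_right) (auto simp: U_def in_keys_iff)
  \<comment> \<open>Among nested finite sets, the one of least cardinality is contained in all the
    others.\<close>
  obtain j where j: "j \<in> J" "\<And>i. i \<in> J \<Longrightarrow> card (U j) \<le> card (U i)"
    using \<open>m \<in> J\<close> arg_min_if_finite(1)[of J "\<lambda>j. card (U j)"] arg_min_least[of J _ "\<lambda>j. card (U j)"]
    by (metis empty_iff finite)
  have "U j \<subseteq> U i" if "i \<in> J" for i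
  proof -
    have "U i \<subseteq> U j \<or> U j \<subseteq> U i"
    proof (rule ccontr)
      assume "\<not> ?thesis"
      then obtain x y where x: "x \<in> U i" "x \<notin> U j" and y: "y \<in> U j" "y \<notin> U i" by blast
      then have "x \<le> y \<or> y \<le> x"
        using assms by (auto simp: U_def standard_def incomparable_def)
      then show False using x y by (auto simp: U_def intro: order_trans)
    qed
    moreover have "finite (U i)" "finite (U j)" by auto
    ultimately show ?thesis using j(2)[OF that] by (metis card_seteq subset_refl)
  qed
  \<comment> \<open>A variable in \<open>U j\<close> lies above every join-prime below
    \<open>u\<close>, hence above \<open>u\<close> itself.\<close>
  then have "U j = U u"
    using j(1) le_iff_join_primes_le[of u] by (fastforce simp: U_def J_def)
  then have "upper_degree d u = upper_degree d j" by (simp add: upper_degree_U)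
  moreover have "upper_degree d u \<le> upper_degree d i" if "i \<in> J" for i
    using that unfolding upper_degree_def by (intro sum_mono2) (auto simp: J_def)
  ultimately show ?thesis
    using j(1) unfolding J_def[symmetric] by (intro Min_eqI[symmetric]) auto
qed

text \<open>The exponents are recovered from the top down: the one at \<open>u\<close> is the upper
  degree at \<open>u\<close> minus the exponents strictly above.\<close>

lemma upper_degree_inject:
  fixes d e :: "'l::{finite, order} \<Rightarrow>\<^sub>0 nat"
  assumes "upper_degree d = upper_degree e"
  shows "d = e"
proof (rule poly_mapping_eqI)
  fix u
  show "Poly_Mapping.lookup d u = Poly_Mapping.lookup e u"
  proof (induction "card {a. u < a}" arbitrary: u rule: less_induct)
    case less
    have split: "upper_degree f u = Poly_Mapping.lookup f u + (\<Sum>a | u < a. Poly_Mapping.lookup f a)"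
      for f :: "'l \<Rightarrow>\<^sub>0 nat"
    proof -
      have "{a. u \<le> a} = insert u {a. u < a}" by auto
      then show ?thesis by (simp add: upper_degree_def)
    qed
    have "Poly_Mapping.lookup d a = Poly_Mapping.lookup e a" if "u < a" for a
      using that by (intro less psubset_card_mono) auto
    then have "(\<Sum>a | u < a. Poly_Mapping.lookup d a) = (\<Sum>a | u < a. Poly_Mapping.lookup e a)"
      by (intro sum.cong) auto
    then show ?case using split[of d] split[of e] assms by simp
  qed
qed

text \<open>For standard monomials the upper degrees at join-primes determine all upper degrees,
  hence the exponents.\<close>

lemma standard_unique_in_fibre:
  fixes d e :: "'l::{finite, distrib_lattice} \<Rightarrow>\<^sub>0 nat"
  assumes "standard d" "standard e" "e \<in> fibre d"
  shows "e = d"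
proof (rule upper_degree_inject, rule ext)
  fix u
  have "upper_degree e ` {j. join_prime j \<and> j \<le> u} = upper_degree d ` {j. join_prime j \<and> j \<le> u}"
    using assms(3) by (intro image_cong) (auto simp: fibre_def)
  then show "upper_degree e u = upper_degree d u"
    by (simp add: upper_degree_standard assms(1,2))
qed

text \<open>A single term times a generator is a difference of two terms with equal coefficients and
  exponents in the same fibre, so its fibre sums vanish; linearity does the rest.\<close>

lemma fibre_sum_hibi_ideal:
  fixes p :: "'l::{finite, lattice} cpoly"
  assumes "p \<in> hibi_ideal"
  shows "(\<Sum>e\<in>fibre d. Poly_Mapping.lookup p e) = 0"
  using assms unfolding hibi_ideal_def
proof (induction rule: poly_ideal.span_induct_alt)
  case base
  then show ?case by simp
next
  case (step q x y)
  then obtain a b where x: "x = X a * X b - X (sup a b) * X (inf a b)" by blast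
  let ?L = "\<lambda>p. \<Sum>e\<in>fibre d. Poly_Mapping.lookup p e"
  have single: "?L (Poly_Mapping.single e c) = (if e \<in> fibre d then c else 0)"
    for e :: "'l \<Rightarrow>\<^sub>0 nat" and c :: complex
    by (simp add: lookup_single when_def finite_fibre)
  have mono: "?L (Poly_Mapping.single e c * x) = 0" for e c
  proof -
    have "Poly_Mapping.single e c * x =
        Poly_Mapping.single (e + (Poly_Mapping.single a 1 + Poly_Mapping.single b 1)) c
        - Poly_Mapping.single (e + (Poly_Mapping.single (sup a b) 1 + Poly_Mapping.single (inf a b) 1)) c"
      by (simp only: x X_mult_X mult_single right_diff_distrib mult_1_right)
    then show ?thesis
      by (simp only: lookup_minus sum_subtractf single swap_in_fibre_iff) simp
  qed
  have "q * x = (\<Sum>e\<in>Poly_Mapping.keys q. Poly_Mapping.single e (Poly_Mapping.lookup q e) * x)"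
    by (simp add: sum_lookup_singles flip: sum_distrib_right)
  then have "?L (q * x) =
      (\<Sum>e\<in>Poly_Mapping.keys q. ?L (Poly_Mapping.single e (Poly_Mapping.lookup q e) * x))"
    by (simp only: lookup_sum) (rule sum.swap)
  then have "?L (q * x) = 0" by (simp only: mono sum.neutral_const)
  then show ?case using step.IH by (simp add: lookup_add sum.distrib)
qed

section \<open>Weights and initial forms\<close>

lemma weight_add: "weight w (d + e) = weight w d + weight w e"
  by (simp add: weight_def lookup_add distrib_left sum.distrib)

lemma weight_single: "weight w (Poly_Mapping.single a 1) = w $ a"
  by (simp add: weight_def lookup_single when_def if_distrib cong: if_cong)

lemma standard_maximises_weight:
  fixes w :: "real ^ 'l::{finite, distrib_lattice}"
  assumes w: "\<And>a b. incomparable a b \<Longrightarrow> w $ a + w $ b < w $ sup a b + w $ inf a b"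
    and d: "standard d" and e: "e \<in> fibre d" "e \<noteq> d"
  shows "weight w e < weight w d"
proof -
  \<comment> \<open>Straightening an incomparable pair stays in the fibre and increases the weight.\<close>
  have max_standard: "standard f" if f: "f \<in> fibre d" "\<And>g. g \<in> fibre d \<Longrightarrow> weight w g \<le> weight w f" for f
  proof (rule ccontr)
    assume "\<not> standard f"
    then obtain a b g where ab: "incomparable a b"
      and fg: "f = g + (Poly_Mapping.single a 1 + Poly_Mapping.single b 1)"
      by (rule nonstandardE)
    then have "weight w (g + (Poly_Mapping.single (sup a b) 1 + Poly_Mapping.single (inf a b) 1)) \<le> weight w f"
      using f by (intro f(2)) (simp only: swap_in_fibre_iff)
    then show False
      using w[OF ab] by (simp only: fg weight_add weight_single)
  qed
  have "d \<in> fibre d" by (simp add: fibre_def)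
  \<comment> \<open>The maximum is attained on the finite fibre, and only at \<open>d\<close>, since
    every maximiser is standard.\<close>
  define M where "M = Max (weight w ` fibre d)"
  have M: "weight w g \<le> M" if "g \<in> fibre d" for g
    using that by (simp add: M_def finite_fibre)
  have "M \<in> weight w ` fibre d"
    using \<open>d \<in> fibre d\<close> unfolding M_def by (intro Max_in) (auto simp: finite_fibre)
  moreover have "f = d" if "f \<in> fibre d" "weight w f = M" for f
    using max_standard[of f] M that d standard_unique_in_fibre by blast
  ultimately show ?thesis using M[OF e(1)] e by (metis imageE order_less_le)
qed

lemma lookup_init_form:
  "Poly_Mapping.lookup (init_form w p) d =
    (if \<forall>e\<in>Poly_Mapping.keys p. weight w d \<le> weight w e then Poly_Mapping.lookup p d else 0)"
proof -
  let ?K = "{d \<in> Poly_Mapping.keys p. \<forall>e\<in>Poly_Mapping.keys p. weight w d \<le> weight w e}"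
  have "finite ?K" by simp
  then have "Poly_Mapping.lookup (init_form w p) d = (if d \<in> ?K then Poly_Mapping.lookup p d else 0)"
    by (simp add: init_form_def lookup_sum lookup_single when_def)
  then show ?thesis by (auto simp: in_keys_iff)
qed

lemma hibi_generator:
  "Poly_Mapping.single (e + (Poly_Mapping.single a 1 + Poly_Mapping.single b 1)) c
    - Poly_Mapping.single (e + (Poly_Mapping.single (sup a b) 1 + Poly_Mapping.single (inf a b) 1)) c
    \<in> hibi_ideal"
proof -
  have "Poly_Mapping.single e c * (X a * X b - X (sup a b) * X (inf a b)) \<in> hibi_ideal"
    unfolding hibi_ideal_def by (intro poly_ideal.span_scale poly_ideal.span_base) blast
  then show ?thesis by (simp only: X_mult_X mult_single right_diff_distrib mult_1_right)
qed

lemma init_form_binomial: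
  assumes "weight w d < weight w e"
  shows "init_form w (Poly_Mapping.single d c - Poly_Mapping.single e c) = Poly_Mapping.single d c"
proof (cases "c = 0")
  case True
  then show ?thesis by (simp add: init_form_def)
next
  case False
  have "d \<noteq> e" using assms by auto
  then have "Poly_Mapping.keys (Poly_Mapping.single d c - Poly_Mapping.single e c) = {d, e}"
    using False by (auto simp: in_keys_iff lookup_minus lookup_single when_def split: if_splits)
  then show ?thesis
    using assms by (intro poly_mapping_eqI)
      (auto simp: lookup_init_form lookup_minus lookup_single when_def)
qed

lemma init_ideal_hibi_if_supermodular:
  fixes w :: "real ^ 'l::{finite, distrib_lattice}"
  assumes w: "\<And>a b. incomparable a b \<Longrightarrow> w $ a + w $ b < w $ sup a b + w $ inf a b"
  shows "init_ideal w hibi_ideal = monomial_ideal"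
proof
  have "init_form w p \<in> monomial_ideal" if "p \<in> hibi_ideal" for p
    unfolding monomial_ideal_iff
  proof (intro ballI notI)
    fix d
    assume "d \<in> Poly_Mapping.keys (init_form w p)" and d: "standard d"
    then have min: "\<And>e. e \<in> Poly_Mapping.keys p \<Longrightarrow> weight w d \<le> weight w e"
      and nz: "Poly_Mapping.lookup p d \<noteq> 0"
      by (auto simp: in_keys_iff lookup_init_form split: if_splits)
    have "d \<in> fibre d" by (simp add: fibre_def)
    \<comment> \<open>Any other \<open>e\<close> in the fibre is lighter than \<open>d\<close>,
      while \<open>d\<close> has least weight in \<open>p\<close>; so \<open>d\<close> alone
      contributes to the fibre sum.\<close>
    have "Poly_Mapping.lookup p e = 0" if "e \<in> fibre d - {d}" for e
      using standard_maximises_weight[OF w d, of e] min[of e] that by (force simp: in_keys_iff)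
    then have "(\<Sum>e\<in>fibre d. Poly_Mapping.lookup p e) = Poly_Mapping.lookup p d"
      by (simp add: sum.remove[OF finite_fibre \<open>d \<in> fibre d\<close>])
    then show False using fibre_sum_hibi_ideal[OF \<open>p \<in> hibi_ideal\<close>] nz by simp
  qed
  moreover have "poly_vec.subspace monomial_ideal"
    unfolding monomial_ideal_def poly_vec.subspace_def cscale_def
    by (auto intro: poly_ideal.span_zero poly_ideal.span_add poly_ideal.span_scale)
  ultimately show "init_ideal w hibi_ideal \<subseteq> monomial_ideal"
    unfolding init_ideal_def by (intro poly_vec.span_minimal) auto
next
  show "monomial_ideal \<subseteq> init_ideal w hibi_ideal"
  proof
    fix p :: "'l cpoly"
    assume p: "p \<in> monomial_ideal"
    have "Poly_Mapping.single d (Poly_Mapping.lookup p d) \<in> cspan (init_form w ` hibi_ideal)"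
      if "d \<in> Poly_Mapping.keys p" for d
    proof -
      have "\<not> standard d" using p that by (simp add: monomial_ideal_iff)
      then obtain a b e where ab: "incomparable a b"
        and d: "d = e + (Poly_Mapping.single a 1 + Poly_Mapping.single b 1)"
        by (rule nonstandardE)
      let ?d' = "e + (Poly_Mapping.single (sup a b) 1 + Poly_Mapping.single (inf a b) 1)"
      have "weight w d < weight w ?d'"
        using w[OF ab] by (simp only: d weight_add weight_single)
      \<comment> \<open>The term at \<open>d\<close> is the lighter term of a Hibi binomial, hence
        its initial form.\<close>
      then show ?thesis
        using init_form_binomial hibi_generator[of e a b] unfolding d[symmetric]
        by (metis image_eqI poly_vec.span_base)
    qed
    then have "(\<Sum>d\<in>Poly_Mapping.keys p. Poly_Mapping.single d (Poly_Mapping.lookup p d))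
        \<in> cspan (init_form w ` hibi_ideal)"
      by (rule poly_vec.span_sum)
    then show "p \<in> init_ideal w hibi_ideal"
      by (simp add: sum_lookup_singles init_ideal_def)
  qed
qed

text \<open>If the inequality fails, even by a tie, the term at \<open>sup a b, inf a b\<close>
  survives in the initial form of the Hibi binomial. Its support is a chain, so it cannot occur in
  the monomial ideal.\<close>

lemma supermodular_if_init_ideal_hibi:
  fixes w :: "real ^ 'l::{finite, lattice}"
  assumes init: "init_ideal w hibi_ideal = monomial_ideal" and ab: "incomparable a b"
  shows "w $ a + w $ b < w $ sup a b + w $ inf a b"
proof (rule ccontr)
  assume neg: "\<not> ?thesis"
  let ?d = "Poly_Mapping.single a 1 + Poly_Mapping.single b 1 :: 'l \<Rightarrow>\<^sub>0 nat"
  let ?e = "Poly_Mapping.single (sup a b) 1 + Poly_Mapping.single (inf a b) 1 :: 'l \<Rightarrow>\<^sub>0 nat"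
  let ?p = "Poly_Mapping.single ?d 1 - Poly_Mapping.single ?e 1 :: 'l cpoly"
  \<comment> \<open>The exponents at \<open>sup a b\<close> tell the two monomials apart, so the
    binomial does not cancel.\<close>
  have "sup a b \<noteq> a" "sup a b \<noteq> b"
    using ab by (metis incomparable_def sup.cobounded1 sup.cobounded2)+
  then have "Poly_Mapping.lookup ?d (sup a b) = 0" "Poly_Mapping.lookup ?e (sup a b) \<noteq> 0"
    by (auto simp: lookup_add lookup_single when_def)
  then have "?d \<noteq> ?e" by metis
  have "?p \<in> hibi_ideal" using hibi_generator[of 0 a b 1] by simp
  then have "init_form w ?p \<in> monomial_ideal"
    unfolding init[symmetric] init_ideal_def by (intro poly_vec.span_base) blast
  moreover have "Poly_Mapping.keys ?p \<subseteq> {?d, ?e}"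
    using keys_diff[of "Poly_Mapping.single ?d (1::complex)" "Poly_Mapping.single ?e 1"] by auto
  then have "\<forall>f\<in>Poly_Mapping.keys ?p. weight w ?e \<le> weight w f"
    using neg by (auto simp only: weight_add weight_single dest!: subsetD)
  then have "?e \<in> Poly_Mapping.keys (init_form w ?p)"
    using \<open>?d \<noteq> ?e\<close> by (simp add: in_keys_iff lookup_init_form lookup_minus lookup_single_not_eq)
  ultimately have "\<not> standard ?e" by (simp add: monomial_ideal_iff)
  moreover have "Poly_Mapping.keys ?e \<subseteq> {sup a b, inf a b}"
    using keys_add[of "Poly_Mapping.single (sup a b) (1::nat)" "Poly_Mapping.single (inf a b) 1"] by auto
  moreover have "inf a b \<le> sup a b" by (simp add: le_infI1 le_supI1)
  ultimately show False by (auto simp: standard_def incomparable_def)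
qed

theorem theorem2p3:
  fixes C :: "(real ^ 'l::{finite, distrib_lattice}) set"
  defines "C \<equiv> init_cone hibi_ideal monomial_ideal"
  shows "C = {w. \<forall>a b. diamond_pair a b \<longrightarrow> w $ a + w $ b < w $ sup a b + w $ inf a b}
    \<and> (\<forall>a b. diamond_pair a b \<longrightarrow>
         {w \<in> closure C. w $ a + w $ b = w $ sup a b + w $ inf a b} facet_of closure C)"
proof -
  have C: "C = {w. \<forall>a b. diamond_pair a b \<longrightarrow> w $ a + w $ b < w $ sup a b + w $ inf a b}"
  proof (intro set_eqI iffI)
    fix w :: "(real, 'l) vec"
    assume "w \<in> C"
    then show "w \<in> {w. \<forall>a b. diamond_pair a b \<longrightarrow> w $ a + w $ b < w $ sup a b + w $ inf a b}"
      using supermodular_if_init_ideal_hibi diamond_pair_imp_incomparable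
      unfolding C_def init_cone_def by blast
  next
    fix w :: "(real, 'l) vec"
    assume "w \<in> {w. \<forall>a b. diamond_pair a b \<longrightarrow> w $ a + w $ b < w $ sup a b + w $ inf a b}"
    then have "w $ a + w $ b < w $ sup a b + w $ inf a b" if "incomparable a b" for a b
      using strictly_supermodular_if_diamonds[of "\<lambda>a. w $ a"] that by blast
    then show "w \<in> C"
      unfolding C_def init_cone_def using init_ideal_hibi_if_supermodular by blast
  qed
  then show ?thesis using diamond_facet by blast
qed

end
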